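(* Let $(x,y)\in\mathbb{Z}_{\geq0}^2$ with $x\ge 8$ or $y\ge 8$. Then $(x,y)$ is a $\mathcal{P}$-position of Wythoff's game if and only if $(x,y)$ is a $\mathcal{P}$-position of the misère variant of Wythoff's game with terminal set $T=\{(x,y):x+y\le 2\}$.
   Context: Moves (queen moves): from $(x,y)\in\mathbb{Z}_{\geq0}^2$ a player may move to any $(u,y)$ with $0\le u<x$, any $(x,v)$ with $0\le v<y$, or any $(x-t,y-t)$ with $1\le t\le\min(x,y)$. Wythoff's game: two players alternate these moves; the player who moves to $(0,0)$ wins. Its $\mathcal{P}$-positions are $\{(\lfloor n\phi\rfloor,\lfloor n(\phi+1)\rfloor)\}\cup\{(\lfloor n(\phi+1)\rfloor,\lfloor n\phi\rfloor)\}$, $n\ge0$, $\phi=\frac{1+\sqrt5}2$. Misère variant: same moves, but the game ends as soon as the position lies in $T=\{(x,y):x+y\le2\}$, and the player who moves the position into $T$ loses. A $\mathcal{P}$-position is one from which the previous player (the one who has just moved) wins with correct play. *)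

theory Defs
  imports Main
begin

definition queen_moves :: "nat \<times> nat \<Rightarrow> (nat \<times> nat) set" where
  "queen_moves p = (case p of (x, y) \<Rightarrow>
     {(u, y) | u. u < x} \<union>
     {(x, v) | v. v < y} \<union>
     {(x - t, y - t) | t. 1 \<le> t \<and> t \<le> min x y})"

text \<open>
  Outcomes of the game in which two players alternate queen moves and which ends as soon as
  the position lies in \<open>T\<close>. The Boolean \<open>mover_wins\<close> tells whether the player who has moved
  the position into \<open>T\<close> wins or loses. \<open>P_position\<close> means that the previous player can force a
  win, \<open>N_position\<close> that the next player can. A position of \<open>T\<close> counts as one that has just
  been moved into. Both terminal sets used below contain \<open>(0, 0)\<close>, so every nonterminal
  position has a move and rule \<open>P_step\<close> never applies vacuously.
\<close>

inductive P_position :: "(nat \<times> nat) set \<Rightarrow> bool \<Rightarrow> nat \<times> nat \<Rightarrow> bool"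
  and N_position :: "(nat \<times> nat) set \<Rightarrow> bool \<Rightarrow> nat \<times> nat \<Rightarrow> bool"
  for T :: "(nat \<times> nat) set" and mover_wins :: bool
where
  P_end: "p \<in> T \<Longrightarrow> mover_wins \<Longrightarrow> P_position T mover_wins p"
| N_end: "p \<in> T \<Longrightarrow> \<not> mover_wins \<Longrightarrow> N_position T mover_wins p"
| P_step: "p \<notin> T \<Longrightarrow> (\<And>q. q \<in> queen_moves p \<Longrightarrow> N_position T mover_wins q)
    \<Longrightarrow> P_position T mover_wins p"
| N_step: "p \<notin> T \<Longrightarrow> q \<in> queen_moves p \<Longrightarrow> P_position T mover_wins q
    \<Longrightarrow> N_position T mover_wins p"

definition wythoff_P_position :: "nat \<times> nat \<Rightarrow> bool" where
  "wythoff_P_position = P_position {(0, 0)} True"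

definition misere_terminal :: "(nat \<times> nat) set" where
  "misere_terminal = {(x, y). x + y \<le> 2}"

definition misere_wythoff_P_position :: "nat \<times> nat \<Rightarrow> bool" where
  "misere_wythoff_P_position = P_position misere_terminal False"

end

theory Submission
  imports Defs
begin

text \<open>
  Within the box \<open>[0,7]\<^sup>2\<close> the two games have different P-positions, but the two sets occupy
  exactly the same rows, columns and diagonals. From a position outside the box, a line of
  movement that meets the box passes through all the box cells on that row, column or diagonal,
  so a P-position of one game can be reached inside the box iff one of the other game can. Hence
  the recursions that determine the P-positions outside the box coincide.
\<close>

text \<open>The diagonal case is an equation of sums because subtraction on \<open>nat\<close>
  truncates; the step length is recovered as \<open>t = x - u\<close>.\<close>

lemma queen_moves_iff:
  "(u, v) \<in> queen_moves (x, y) \<longleftrightarrow>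
     u < x \<and> v = y \<or> u = x \<and> v < y \<or> u < x \<and> v < y \<and> u + y = v + x"
proof -
  have "(\<exists>t. u = x - t \<and> v = y - t \<and> 1 \<le> t \<and> t \<le> min x y)
      \<longleftrightarrow> u < x \<and> v < y \<and> u + y = v + x" (is "?L \<longleftrightarrow> ?R")
  proof
    assume ?R
    then have "u = x - (x - u) \<and> v = y - (x - u) \<and> 1 \<le> x - u \<and> x - u \<le> min x y"
      by auto
    then show ?L by blast
  qed auto
  then show ?thesis
    by (auto simp: queen_moves_def)
qed

lemma queen_moves_decrease:
  "q \<in> queen_moves p \<Longrightarrow> fst q + snd q < fst p + snd p"
  by (cases p; cases q) (auto simp: queen_moves_iff)

lemma queen_moves_induct [case_names moves]:
  assumes "\<And>p. (\<And>q. q \<in> queen_moves p \<Longrightarrow> Q q) \<Longrightarrow> Q p"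
  shows "Q p"
proof (induction p rule: measure_induct_rule[of "\<lambda>p. fst p + snd p"])
  case (less p)
  then show ?case
    using assms queen_moves_decrease by blast
qed

text \<open>Play is finite, and outside \<open>T\<close> the two step rules quantify dually over the
  options. Induction along moves therefore shows both that every position has an outcome and that
  none has two.\<close>

lemma N_position_iff_not_P_position:
  "N_position T m p \<longleftrightarrow> \<not> P_position T m p"
proof (induction p rule: queen_moves_induct)
  case (moves p)
  show ?case
  proof (cases "p \<in> T")
    case True
    then show ?thesis
      by (auto elim: P_position.cases N_position.cases intro: P_end N_end)
  next
    case False
    have "P_position T m p \<longleftrightarrow> (\<forall>q\<in>queen_moves p. N_position T m q)"
      using False by (auto elim: P_position.cases intro: P_step)
    moreover have "N_position T m p \<longleftrightarrow> (\<exists>q\<in>queen_moves p. P_position T m q)"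
      using False by (auto elim: N_position.cases intro: N_step)
    ultimately show ?thesis
      using moves by blast
  qed
qed

lemma P_position_iff:
  "P_position T m p \<longleftrightarrow>
     (if p \<in> T then m else \<forall>q\<in>queen_moves p. \<not> P_position T m q)"
proof (cases "p \<in> T")
  case True
  then show ?thesis
    by (auto elim: P_position.cases intro: P_end)
next
  case False
  then show ?thesis
    by (auto simp flip: N_position_iff_not_P_position elim: P_position.cases intro: P_step)
qed

text \<open>No move increases a coordinate, so play from the box stays there. The recursion thus has
  a unique solution on the box, and a guessed \<open>S\<close> only has to be checked against it at
  finitely many cells.\<close>

lemma P_position_in_box:
  assumes box: "\<And>x y. x \<le> n \<Longrightarrow> y \<le> n \<Longrightarrow>
    (x, y) \<in> S \<longleftrightarrow> (if (x, y) \<in> T then m else \<forall>q\<in>S. q \<notin> queen_moves (x, y))"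
    and "x \<le> n" "y \<le> n"
  shows "P_position T m (x, y) \<longleftrightarrow> (x, y) \<in> S"
proof -
  have "fst p \<le> n \<Longrightarrow> snd p \<le> n \<Longrightarrow> P_position T m p \<longleftrightarrow> p \<in> S" for p
  proof (induction p rule: queen_moves_induct)
    case (moves p)
    obtain x y where p: "p = (x, y)" by fastforce
    have "P_position T m q \<longleftrightarrow> q \<in> S" if "q \<in> queen_moves p" for q
      using that moves by (cases q) (force simp: p queen_moves_iff)
    then show ?case
      using box[of x y] moves.prems by (subst P_position_iff) (auto simp: p)
  qed
  then show ?thesis
    using assms(2,3) by simp
qed

text \<open>The last clause is \<open>u - v = a - b\<close> over the integers, i.e. a common
  diagonal. The relation is one-sided; holding in both directions, it says that the two sets occupy
  the same lines.\<close>

definition meets_lines_of :: "(nat \<times> nat) set \<Rightarrow> (nat \<times> nat) set \<Rightarrow> bool" where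
  "meets_lines_of S' S \<longleftrightarrow> (\<forall>(a, b)\<in>S.
     (\<exists>(u, v)\<in>S'. u = a) \<and> (\<exists>(u, v)\<in>S'. v = b) \<and> (\<exists>(u, v)\<in>S'. u + b = v + a))"

lemma meets_lines_of_queen_moves:
  assumes "meets_lines_of S' S" "S \<subseteq> {..n} \<times> {..n}" "S' \<subseteq> {..n} \<times> {..n}"
    and "n < x \<or> n < y"
    and "q \<in> S" "q \<in> queen_moves (x, y)"
  shows "\<exists>q'\<in>S'. q' \<in> queen_moves (x, y)"
proof -
  obtain a b where q: "q = (a, b)" by fastforce
  have ab: "a \<le> n" "b \<le> n" using assms(2,5) by (auto simp: q)
  have S': "u \<le> n \<and> v \<le> n" if "(u, v) \<in> S'" for u v using assms(3) that by auto
  obtain u1 v1 u2 v2 u3 v3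
    where "(u1, v1) \<in> S'" "u1 = a" "(u2, v2) \<in> S'" "v2 = b" "(u3, v3) \<in> S'" "u3 + b = v3 + a"
    using assms(1,5) unfolding meets_lines_of_def q by fastforce
  note w = this
  consider "a < x" "b = y" | "a = x" "b < y" | "a < x" "b < y" "a + y = b + x"
    using assms(6) by (auto simp: q queen_moves_iff)
  then show ?thesis
  proof cases
    case 1
    \<comment> \<open>Since \<open>y = b \<le> n\<close>, it is \<open>x\<close> that exceeds
      \<open>n\<close>, so any box cell with second coordinate \<open>y\<close> is
      reachable.\<close>
    then have "(u2, v2) \<in> queen_moves (x, y)"
      using w S'[OF w(3)] ab assms(4) by (auto simp: queen_moves_iff)
    then show ?thesis using w by blast
  next
    case 2
    then have "(u1, v1) \<in> queen_moves (x, y)"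
      using w S'[OF w(1)] ab assms(4) by (auto simp: queen_moves_iff)
    then show ?thesis using w by blast
  next
    case 3
    \<comment> \<open>The two diagonal equations give \<open>u3 + y = v3 + x\<close>. One of
      \<open>u3 < x\<close> and \<open>v3 < y\<close> holds because that coordinate of
      \<open>(x, y)\<close> exceeds \<open>n\<close>, and the equation yields the other.\<close>
    then have "(u3, v3) \<in> queen_moves (x, y)"
      using w S'[OF w(5)] assms(4) by (auto simp: queen_moves_iff)
    then show ?thesis using w by blast
  qed
qed

lemma P_position_eq_outside_box:
  assumes box: "\<And>x y. x \<le> n \<Longrightarrow> y \<le> n \<Longrightarrow> P_position T m (x, y) \<longleftrightarrow> (x, y) \<in> S"
    and box': "\<And>x y. x \<le> n \<Longrightarrow> y \<le> n \<Longrightarrow> P_position T' m' (x, y) \<longleftrightarrow> (x, y) \<in> S'"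
    and S: "S \<subseteq> {..n} \<times> {..n}" and S': "S' \<subseteq> {..n} \<times> {..n}"
    and T: "T \<subseteq> {..n} \<times> {..n}" and T': "T' \<subseteq> {..n} \<times> {..n}"
    and lines: "meets_lines_of S' S" "meets_lines_of S S'"
    and "n < x \<or> n < y"
  shows "P_position T m (x, y) \<longleftrightarrow> P_position T' m' (x, y)"
proof -
  have "n < fst p \<or> n < snd p \<Longrightarrow> P_position T m p \<longleftrightarrow> P_position T' m' p" for p
  proof (induction p rule: queen_moves_induct)
    case (moves p)
    obtain x y where p: "p = (x, y)" by fastforce
    have out: "n < x \<or> n < y" using moves.prems by (simp add: p)
    \<comment> \<open>Options inside the box are decided by the known set \<open>Q\<close>; the
      induction hypothesis is needed only for those outside.\<close>
    have split: "(\<exists>q\<in>queen_moves p. R q) \<longleftrightarrow>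
        (\<exists>q\<in>Q. q \<in> queen_moves p) \<or> (\<exists>q\<in>queen_moves p. (n < fst q \<or> n < snd q) \<and> R q)"
      if "\<And>x y. x \<le> n \<Longrightarrow> y \<le> n \<Longrightarrow> R (x, y) \<longleftrightarrow> (x, y) \<in> Q" "Q \<subseteq> {..n} \<times> {..n}"
      for R :: "nat \<times> nat \<Rightarrow> bool" and Q
    proof -
      have "q \<in> Q \<longleftrightarrow> R q \<and> \<not> (n < fst q \<or> n < snd q)" for q
        using that by (cases q) (auto simp: not_less)
      then show ?thesis by blast
    qed
    have "(\<exists>q\<in>S. q \<in> queen_moves p) \<longleftrightarrow> (\<exists>q\<in>S'. q \<in> queen_moves p)"
      using meets_lines_of_queen_moves[OF lines(1) S S' out]
        meets_lines_of_queen_moves[OF lines(2) S' S out] unfolding p by blast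
    then have "(\<exists>q\<in>queen_moves p. P_position T m q) \<longleftrightarrow> (\<exists>q\<in>queen_moves p. P_position T' m' q)"
      using split[of "P_position T m" S, OF box S] split[of "P_position T' m'" S', OF box' S']
        moves.IH by blast
    \<comment> \<open>Both terminal sets lie in the box, so at \<open>p\<close> both games follow
      the same recursion and \<open>m\<close>, \<open>m'\<close> do not enter.\<close>
    moreover have "p \<notin> T" "p \<notin> T'" using T T' out by (auto simp: p)
    ultimately show ?case
      using P_position_iff[of T m p] P_position_iff[of T' m' p] by auto
  qed
  then show ?thesis
    using assms(9) by simp
qed

text \<open>The Wythoff pairs 0-0, 1-2, 3-5 and 4-7 in both orders; the next pair, 6-10, leaves the
  box.\<close>

definition wythoff_box :: "(nat \<times> nat) set" where
  "wythoff_box = {(0, 0), (1, 2), (2, 1), (3, 5), (5, 3), (4, 7), (7, 4)}"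

text \<open>Like \<open>wythoff_box\<close>, this has one cell in each row and each column 0 to 5
  and 7, none in 6, and one on each diagonal of difference -3 to 3.\<close>

definition misere_box :: "(nat \<times> nat) set" where
  "misere_box = {(0, 3), (3, 0), (1, 2), (2, 1), (4, 4), (5, 7), (7, 5)}"

lemma le_7_cases:
  "(x::nat) \<le> 7 \<Longrightarrow> x = 0 \<or> x = 1 \<or> x = 2 \<or> x = 3 \<or> x = 4 \<or> x = 5 \<or> x = 6 \<or> x = 7"
  by linarith

lemma wythoff_P_position_in_box:
  assumes "x \<le> 7" "y \<le> 7"
  shows "P_position {(0, 0)} True (x, y) \<longleftrightarrow> (x, y) \<in> wythoff_box"
proof (rule P_position_in_box[OF _ assms])
  fix x y :: nat
  assume "x \<le> 7" "y \<le> 7"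
  from this[THEN le_7_cases] show "(x, y) \<in> wythoff_box \<longleftrightarrow>
      (if (x, y) \<in> {(0, 0)} then True else \<forall>q\<in>wythoff_box. q \<notin> queen_moves (x, y))"
    by (elim disjE) (simp_all add: wythoff_box_def queen_moves_iff)
qed

lemma misere_P_position_in_box:
  assumes "x \<le> 7" "y \<le> 7"
  shows "P_position misere_terminal False (x, y) \<longleftrightarrow> (x, y) \<in> misere_box"
proof (rule P_position_in_box[OF _ assms])
  fix x y :: nat
  assume "x \<le> 7" "y \<le> 7"
  from this[THEN le_7_cases] show "(x, y) \<in> misere_box \<longleftrightarrow>
      (if (x, y) \<in> misere_terminal then False else \<forall>q\<in>misere_box. q \<notin> queen_moves (x, y))"
    by (elim disjE) (simp_all add: misere_box_def misere_terminal_def queen_moves_iff)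
qed

theorem theorem5p6:
  fixes x y :: nat
  assumes "x \<ge> 8 \<or> y \<ge> 8"
  shows "wythoff_P_position (x, y) \<longleftrightarrow> misere_wythoff_P_position (x, y)"
  unfolding wythoff_P_position_def misere_wythoff_P_position_def
proof (rule P_position_eq_outside_box[OF wythoff_P_position_in_box misere_P_position_in_box])
  show "meets_lines_of misere_box wythoff_box" "meets_lines_of wythoff_box misere_box"
    by (simp_all add: meets_lines_of_def wythoff_box_def misere_box_def)
  show "7 < x \<or> 7 < y" using assms by linarith
qed (auto simp: wythoff_box_def misere_box_def misere_terminal_def)

end
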